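(* Let $X$ be a Banach space and $R(u)=\|u\|_X$. Suppose that the following approximate source conditions hold with some orders $r_1,r_2\ge0$ and constants $C_1,C_2$: for all sufficiently small $\beta>0$, $$\inf_{w\in Y}\{\|w\|_Y^2:\ S(\mu^\dagger-K^*w)\le\beta\}\le C_1\beta^{-r_1},\qquad \inf_{w\in Y}\{\|w\|_Y^2:\ S(\eta-K^*w)\le\beta\}\le C_2\beta^{-r_2}.$$ For the choice $\alpha\simeq\delta^\kappa$, where $$\kappa=\begin{cases}\dfrac{(1+r_1)(2+r_2)}{(2+r_1)(1+r_2)}&\text{for } r_1\le r_2,\\[2mm] 1&\text{for } r_2<r_1,\end{cases}$$ we have $$D_R^{\mu_\alpha^\delta,\mu^\dagger}(u_\alpha^\delta,u^\dagger)\lesssim\begin{cases}\delta^{\frac{2+r_2}{(2+r_1)(1+r_2)}}&\text{for } r_1\le r_2,\\ \delta^{\frac1{1+r_1}}&\text{for } r_2<r_1.\end{cases}$$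
   Context: $X$ is a separable Banach space and $Y$ a separable Hilbert space, identified with its dual. $(Z,Y,Z^* )$ is a Gelfand triple: $Z\subset Y$ is a dense subspace with Banach space structure and $\langle u,v\rangle_{Z\times Z^*}=\langle u,v\rangle_Y$ for $u\in Z$, $v\in Y\subset Z^*$. $K:X\to Y$ is a continuous linear operator, also continuous as a map $X\to Z$; its adjoint extends continuously to $K^*:Z^*\to X^*$. The noisy data are $f^\delta=Ku^\dagger+\delta n\in Z^*$ with $n\in Z^*$, $\eta=K^*n$, where $u^\dagger\in X$ is a solution of $Ku=f$ minimizing $R$ among all solutions, and $\mu^\dagger\in\partial R(u^\dagger)$. For $\alpha,\delta>0$, $u_\alpha^\delta$ is a minimizer of $J_\alpha^\delta(u)=\frac12\|Ku\|_Y^2-\langle Ku,f^\delta\rangle_{Z\times Z^*}+\alpha R(u)$, and $\mu_\alpha^\delta\in\partial R(u_\alpha^\delta)$ is the subgradient with $K^*(Ku_\alpha^\delta-f^\delta)+\alpha\mu_\alpha^\delta=0$. Standing assumption: there is a topology $\tau$ on $X$ in which $R$ is lower semicontinuous, sublevel sets of $R$ are sequentially compact, and $K:X\to Z$ is continuous. The dual norm is $S(q)=\sup_{R(u)\le1}\langle q,u\rangle_{X^*\times X}$, $q\in X^*$. The symmetric Bregman distance is $D_R^{\mu_u,\mu_v}(u,v)=\langle\mu_u-\mu_v,u-v\rangle_{X^*\times X}$ for $\mu_u\in\partial R(u)$, $\mu_v\in\partial R(v)$. $a\simeq b$ means $a$ and $b$ are bounded by constant multiples of each other, and $a\lesssim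 b$ means $a\le Cb$, with constants independent of $\delta$, for all sufficiently small $\delta>0$. *)

theory Defs
  imports "HOL-Analysis.Analysis"
begin

text \<open>
  Separable Banach and Hilbert spaces are types of sort
  \<open>{banach, second_countable_topology}\<close> and \<open>{real_inner, banach, second_countable_topology}\<close>;
  the topological dual of \<open>'x\<close> is the Banach space \<open>'x \<Rightarrow>\<^sub>L real\<close>.

  The dense subspace Z of Y carries a norm of its own, so it is a separate Banach space type
  with inclusion map \<open>\<iota> :: 'z \<Rightarrow>\<^sub>L 'y\<close>. Boundedness of \<open>\<iota>\<close> is no extra requirement: it is needed for
  \<open>\<langle>\<cdot>, v\<rangle>\<^sub>Y\<close> to be an element of the dual of Z for every v in Y, and follows from it by uniform
  boundedness.
\<close>

definition gelfand_triple ::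
  "('z::banach \<Rightarrow>\<^sub>L 'y::{real_inner, banach}) \<Rightarrow> bool" where
  "gelfand_triple \<iota> \<longleftrightarrow> inj (blinfun_apply \<iota>) \<and> closure (range (blinfun_apply \<iota>)) = UNIV"

text \<open>The inclusion of Y in the dual of Z: \<open>v \<mapsto> (u \<mapsto> \<langle>u, v\<rangle>\<^sub>Y)\<close>.\<close>

definition to_dual ::
  "('z::banach \<Rightarrow>\<^sub>L 'y::{real_inner, banach}) \<Rightarrow> 'y \<Rightarrow> ('z \<Rightarrow>\<^sub>L real)" where
  "to_dual \<iota> v = blinfun_inner_left v o\<^sub>L \<iota>"

text \<open>
  The Banach space adjoint, mapping the dual of Z to the dual of X. For \<open>T\<close> the operator K
  regarded as a map into Z, it extends the Hilbert space adjoint: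
  \<open>dual_adjoint T (to_dual \<iota> w)\<close> is the functional \<open>u \<mapsto> \<langle>K u, w\<rangle>\<^sub>Y\<close>.
\<close>

definition dual_adjoint ::
  "('x::real_normed_vector \<Rightarrow>\<^sub>L 'z::real_normed_vector) \<Rightarrow> ('z \<Rightarrow>\<^sub>L real) \<Rightarrow> ('x \<Rightarrow>\<^sub>L real)" where
  "dual_adjoint T q = q o\<^sub>L T"

definition subdifferential ::
  "('x::real_normed_vector \<Rightarrow> real) \<Rightarrow> 'x \<Rightarrow> ('x \<Rightarrow>\<^sub>L real) set" where
  "subdifferential R u = {\<mu>. \<forall>v. R u + blinfun_apply \<mu> (v - u) \<le> R v}"

definition bregman_sym ::
  "('x::real_normed_vector \<Rightarrow>\<^sub>L real) \<Rightarrow> ('x \<Rightarrow>\<^sub>L real) \<Rightarrow> 'x \<Rightarrow> 'x \<Rightarrow> real" where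
  "bregman_sym \<mu>u \<mu>v u v = blinfun_apply (\<mu>u - \<mu>v) (u - v)"

definition dual_norm ::
  "('x::real_normed_vector \<Rightarrow> real) \<Rightarrow> ('x \<Rightarrow>\<^sub>L real) \<Rightarrow> ereal" where
  "dual_norm R q = (SUP u\<in>{u. R u \<le> 1}. ereal (blinfun_apply q u))"

definition functional_J ::
  "('x::real_normed_vector \<Rightarrow>\<^sub>L 'y::real_normed_vector) \<Rightarrow> ('x \<Rightarrow>\<^sub>L 'z::real_normed_vector) \<Rightarrow>
   ('x \<Rightarrow> real) \<Rightarrow> ('z \<Rightarrow>\<^sub>L real) \<Rightarrow> real \<Rightarrow> 'x \<Rightarrow> real" where
  "functional_J K T R f\<delta> \<alpha> u =
     1/2 * (norm (blinfun_apply K u))\<^sup>2 - blinfun_apply f\<delta> (blinfun_apply T u) + \<alpha> * R u"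

text \<open>
  Distance function of the approximate source condition for \<open>q\<close> in the dual of X. It takes values
  in \<^typ>\<open>ereal\<close>, so that the infimum is \<open>\<infinity>\<close> when no w is admissible.
\<close>

definition source_inf ::
  "('x::real_normed_vector \<Rightarrow> real) \<Rightarrow> ('x \<Rightarrow>\<^sub>L 'z::banach) \<Rightarrow>
   ('z \<Rightarrow>\<^sub>L 'y::{real_inner, banach}) \<Rightarrow> ('x \<Rightarrow>\<^sub>L real) \<Rightarrow> real \<Rightarrow> ereal" where
  "source_inf R T \<iota> q \<beta> =
     (INF w\<in>{w. dual_norm R (q - dual_adjoint T (to_dual \<iota> w)) \<le> ereal \<beta>}. ereal ((norm w)\<^sup>2))"

definition seq_compactin :: "'a topology \<Rightarrow> 'a set \<Rightarrow> bool" where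
  "seq_compactin \<tau> S \<longleftrightarrow> S \<subseteq> topspace \<tau> \<and>
     (\<forall>\<sigma>::nat \<Rightarrow> 'a. range \<sigma> \<subseteq> S \<longrightarrow>
        (\<exists>l\<in>S. \<exists>r. strict_mono r \<and> limitin \<tau> (\<sigma> \<circ> r) l sequentially))"

definition admissible_topology ::
  "'x topology \<Rightarrow> ('x::real_normed_vector \<Rightarrow> real) \<Rightarrow> ('x \<Rightarrow>\<^sub>L 'z::real_normed_vector) \<Rightarrow> bool" where
  "admissible_topology \<tau> R T \<longleftrightarrow>
     topspace \<tau> = UNIV \<and>
     (\<forall>c. openin \<tau> {u. c < R u}) \<and>
     (\<forall>c. seq_compactin \<tau> {u. R u \<le> c}) \<and>
     continuous_map \<tau> euclidean (blinfun_apply T)"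

text \<open>Asymptotic comparison as \<open>\<delta> \<rightarrow> 0\<close>, \<open>\<delta> > 0\<close>.\<close>

definition asymp_le :: "(real \<Rightarrow> real) \<Rightarrow> (real \<Rightarrow> real) \<Rightarrow> bool"  (infix "\<lesssim>" 50) where
  "a \<lesssim> b \<longleftrightarrow> (\<exists>C>0. eventually (\<lambda>\<delta>. a \<delta> \<le> C * b \<delta>) (at_right 0))"

definition asymp_eq :: "(real \<Rightarrow> real) \<Rightarrow> (real \<Rightarrow> real) \<Rightarrow> bool"  (infix "\<simeq>" 50) where
  "a \<simeq> b \<longleftrightarrow> a \<lesssim> b \<and> b \<lesssim> a"

end

theory Submission
  imports Defs
begin

text \<open>
  The proof rests on one energy identity. Pairing the optimality condition with the error
  \<open>e = u - udag\<close> gives \<open>\<parallel>K e\<parallel>\<^sup>2 + \<alpha> \<langle>\<mu>, e\<rangle> = \<delta> \<langle>\<eta>, e\<rangle>\<close> (\<open>energy_identity\<close>); subtracting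
  \<open>\<alpha> \<langle>\<mu>dag, e\<rangle>\<close> turns the second term into \<open>\<alpha>\<close> times the Bregman distance. The resulting right-hand
  side \<open>\<langle>\<delta> \<eta> - \<alpha> \<mu>dag, e\<rangle>\<close> cannot be absorbed directly, because \<open>\<eta>\<close> and \<open>\<mu>dag\<close> need not be of the
  form \<open>K\<^sup>* w\<close> with w in Y. The approximate source conditions split each of them into \<open>K\<^sup>* w\<close>,
  whose pairing with \<open>e\<close> is absorbed into \<open>\<parallel>K e\<parallel>\<^sup>2\<close> by Young's inequality at the price of \<open>\<parallel>w\<parallel>\<^sup>2\<close>, and a remainder of size
  \<open>\<beta> \<parallel>e\<parallel>\<close>. Hence the Bregman distance is at most
    \<open>\<delta>\<^sup>2 \<beta>2 powr (- r2) / \<alpha> + \<alpha> \<beta>1 powr (- r1) + (\<delta> \<beta>2 / \<alpha> + \<beta>1) \<parallel>e\<parallel>\<close>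
  up to constants (\<open>bregman_le\<close>).

  Since R is the norm, the same splitting of \<open>\<eta>\<close> alone shows that \<open>e\<close> stays bounded
  (\<open>norm_error_le\<close>). The balancing choices \<open>\<beta>2 = \<delta> powr (1 / (1 + r2))\<close> and
  \<open>\<beta>1 = \<alpha> powr (1 / (1 + r1))\<close> make the \<open>\<beta>2\<close> terms of equal order, likewise the
  \<open>\<beta>1\<close> terms (\<open>balanced_powr\<close>), and leave
  \<open>\<delta> powr s / \<alpha> + \<alpha> powr (1 / (1 + r1))\<close> with \<open>s = (2 + r2) / (1 + r2)\<close>. For \<open>r1 \<le> r2\<close> the exponent
  \<open>\<kappa>\<close> makes these two terms equal in order; for \<open>r2 < r1\<close> and \<open>\<kappa> = 1\<close> the second one dominates.
\<close>

section \<open>Approximate source elements\<close>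

lemma apply_le_if_dual_norm_le:
  assumes "dual_norm norm q \<le> ereal \<beta>"
  shows "blinfun_apply q v \<le> \<beta> * norm v"
proof (cases "v = 0")
  case False
  let ?e = "(1 / norm v) *\<^sub>R v"
  have "ereal (blinfun_apply q ?e) \<le> dual_norm norm q"
    unfolding dual_norm_def by (rule SUP_upper) (use False in simp)
  with assms have "ereal (blinfun_apply q ?e) \<le> ereal \<beta>" by (rule order.trans[rotated])
  then show ?thesis using False by (simp add: blinfun.scaleR_right field_simps)
qed simp

text \<open>
  The infimum in the source condition need not be attained; an arbitrarily small increase of
  the bound buys an actual source element.
\<close>

lemma source_element:
  fixes K :: "'x::banach \<Rightarrow>\<^sub>L 'y::{real_inner, banach}"
  assumes K: "\<And>v. blinfun_apply \<iota> (blinfun_apply T v) = blinfun_apply K v"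
    and bound: "source_inf norm T \<iota> q \<beta> \<le> ereal c" "c < c'"
  obtains w where "(norm w)\<^sup>2 \<le> c'"
    and "\<And>v. \<bar>blinfun_apply q v - inner (blinfun_apply K v) w\<bar> \<le> \<beta> * norm v"
proof -
  have "source_inf norm T \<iota> q \<beta> < ereal c'"
    using bound by (simp add: order.strict_trans1)
  then obtain w where w: "dual_norm norm (q - dual_adjoint T (to_dual \<iota> w)) \<le> ereal \<beta>"
    and small: "(norm w)\<^sup>2 < c'"
    unfolding source_inf_def INF_less_iff by auto
  have le: "blinfun_apply q v - inner (blinfun_apply K v) w \<le> \<beta> * norm v" for v
    using apply_le_if_dual_norm_le[OF w, of v]
    by (simp add: blinfun.diff_left dual_adjoint_def to_dual_def K)
  have "\<bar>blinfun_apply q v - inner (blinfun_apply K v) w\<bar> \<le> \<beta> * norm v" for v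
    using le[of v] le[of "- v"] by (simp add: blinfun.minus_right)
  with small show thesis by (intro that) auto
qed

section \<open>Estimates at fixed parameters\<close>

lemma energy_identity:
  fixes K :: "'x::banach \<Rightarrow>\<^sub>L 'y::{real_inner, banach}"
  assumes K: "\<And>v. blinfun_apply \<iota> (blinfun_apply T v) = blinfun_apply K v"
    and opt: "dual_adjoint T (to_dual \<iota> (blinfun_apply K u)
                - (to_dual \<iota> (blinfun_apply K v) + d *\<^sub>R n)) + a *\<^sub>R \<mu> = 0"
  shows "(norm (blinfun_apply K (u - v)))\<^sup>2 + a * blinfun_apply \<mu> (u - v)
         = d * blinfun_apply (dual_adjoint T n) (u - v)"
proof -
  have "blinfun_apply (dual_adjoint T (to_dual \<iota> (blinfun_apply K u)
          - (to_dual \<iota> (blinfun_apply K v) + d *\<^sub>R n)) + a *\<^sub>R \<mu>) (u - v) = 0"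
    using opt by simp
  then show ?thesis
    by (simp add: dual_adjoint_def to_dual_def K power2_norm_eq_inner inner_diff_right
        blinfun.diff_left blinfun.add_left blinfun.scaleR_left blinfun.diff_right[of K])
qed

lemma inner_le_young:
  fixes x y :: "'y::real_inner"
  shows "inner x y \<le> (norm x)\<^sup>2 + (norm y)\<^sup>2 / 4"
proof -
  have "0 \<le> inner (x - y /\<^sub>R 2) (x - y /\<^sub>R 2)" by simp
  also have "\<dots> = inner x x - inner x y + inner y y / 4"
    by (simp add: inner_diff_left inner_diff_right inner_commute)
  finally show ?thesis by (simp add: power2_norm_eq_inner)
qed

text \<open>
  The subgradient inequality at \<open>u\<close> turns the energy identity into
  \<open>a (\<parallel>u\<parallel> - \<parallel>v\<parallel>) \<le> d \<langle>\<eta>, u - v\<rangle> - \<parallel>K (u - v)\<parallel>\<^sup>2\<close>. The remainder of \<open>\<eta>\<close> is linear in \<open>\<parallel>u\<parallel>\<close>, so it can be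
  absorbed on the left as soon as \<open>d \<beta> \<le> a / 2\<close>.
\<close>

lemma norm_error_le:
  fixes K :: "'x::banach \<Rightarrow>\<^sub>L 'y::{real_inner, banach}"
  assumes pos: "a > 0" "d > 0"
    and energy: "(norm (blinfun_apply K (u - v)))\<^sup>2 + a * blinfun_apply \<mu> (u - v)
                 = d * blinfun_apply \<eta> (u - v)"
    and sub: "\<mu> \<in> subdifferential norm u"
    and w: "\<And>x. \<bar>blinfun_apply \<eta> x - inner (blinfun_apply K x) w\<bar> \<le> \<beta> * norm x"
    and small: "d * \<beta> \<le> a / 2" and cost: "d\<^sup>2 * (norm w)\<^sup>2 \<le> a * B"
  shows "norm (u - v) \<le> 4 * norm v + B"
proof -
  let ?e = "u - v"
  have "norm u + blinfun_apply \<mu> (v - u) \<le> norm v"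
    using sub by (simp add: subdifferential_def)
  then have "norm u - norm v \<le> blinfun_apply \<mu> ?e"
    by (simp add: blinfun.diff_right)
  then have "a * (norm u - norm v) \<le> a * blinfun_apply \<mu> ?e"
    using pos by simp
  moreover have "d * blinfun_apply \<eta> ?e \<le> d * (inner (blinfun_apply K ?e) w + \<beta> * norm ?e)"
    using w[of ?e] pos by (intro mult_left_mono) auto
  moreover have "d * inner (blinfun_apply K ?e) w \<le> (norm (blinfun_apply K ?e))\<^sup>2 + a * B / 4"
    using inner_le_young[of "blinfun_apply K ?e" "d *\<^sub>R w"] cost
    by (simp add: power_mult_distrib)
  moreover have "d * \<beta> * norm ?e \<le> a / 2 * (norm u + norm v)"
    using small pos by (intro mult_mono norm_triangle_ineq4) auto
  ultimately have "a * (norm u - norm v) \<le> a * B / 4 + a / 2 * (norm u + norm v)"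
    using energy unfolding distrib_left[of d] mult.assoc[symmetric, of d] by linarith
  then have "a * norm u \<le> a * (3 * norm v + B / 2)" by (simp add: field_simps)
  then have "norm u \<le> 3 * norm v + B / 2" using pos by simp
  moreover have "0 \<le> a * B" using cost by (rule order.trans[rotated]) simp
  then have "0 \<le> B" using pos by (simp add: zero_le_mult_iff)
  ultimately show ?thesis using norm_triangle_ineq4[of u v] by simp
qed

text \<open>
  Both source elements enter as the single element \<open>d w2 - a w1\<close>, because the Bregman distance
  pairs the error with \<open>d \<eta> - a \<mu>dag\<close>; Young's inequality is used once.
\<close>

lemma bregman_le:
  fixes K :: "'x::banach \<Rightarrow>\<^sub>L 'y::{real_inner, banach}"
  assumes pos: "a > 0" "d > 0"
    and energy: "(norm (blinfun_apply K (u - v)))\<^sup>2 + a * blinfun_apply \<mu> (u - v)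
                 = d * blinfun_apply \<eta> (u - v)"
    and w1: "\<And>x. \<bar>blinfun_apply \<nu> x - inner (blinfun_apply K x) w1\<bar> \<le> \<beta>1 * norm x"
    and w2: "\<And>x. \<bar>blinfun_apply \<eta> x - inner (blinfun_apply K x) w2\<bar> \<le> \<beta>2 * norm x"
  shows "bregman_sym \<mu> \<nu> u v
         \<le> d\<^sup>2 * (norm w2)\<^sup>2 / a + a * (norm w1)\<^sup>2 + (d * \<beta>2 / a + \<beta>1) * norm (u - v)"
proof -
  let ?e = "u - v" and ?w = "d *\<^sub>R w2 - a *\<^sub>R w1"
  have "a * bregman_sym \<mu> \<nu> u v
        = d * blinfun_apply \<eta> ?e - a * blinfun_apply \<nu> ?e - (norm (blinfun_apply K ?e))\<^sup>2"
    using energy by (simp add: bregman_sym_def blinfun.diff_left algebra_simps)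
  moreover have "d * blinfun_apply \<eta> ?e \<le> d * (inner (blinfun_apply K ?e) w2 + \<beta>2 * norm ?e)"
    using w2[of ?e] pos by (intro mult_left_mono) auto
  moreover have "a * (inner (blinfun_apply K ?e) w1 - \<beta>1 * norm ?e) \<le> a * blinfun_apply \<nu> ?e"
    using w1[of ?e] pos by (intro mult_left_mono) auto
  moreover have "inner (blinfun_apply K ?e) ?w \<le> (norm (blinfun_apply K ?e))\<^sup>2 + (norm ?w)\<^sup>2 / 4"
    by (rule inner_le_young)
  moreover have "(norm ?w)\<^sup>2 \<le> 2 * (d\<^sup>2 * (norm w2)\<^sup>2) + 2 * (a\<^sup>2 * (norm w1)\<^sup>2)"
  proof -
    have "(norm ?w)\<^sup>2 \<le> (norm ?w)\<^sup>2 + (norm (d *\<^sub>R w2 + a *\<^sub>R w1))\<^sup>2" by simp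
    also have "\<dots> = 2 * (d\<^sup>2 * (norm w2)\<^sup>2) + 2 * (a\<^sup>2 * (norm w1)\<^sup>2)"
      unfolding power2_norm_eq_inner
      by (simp add: inner_diff_left inner_diff_right inner_add_left
          inner_add_right power2_eq_square inner_commute)
    finally show ?thesis .
  qed
  moreover have "0 \<le> d\<^sup>2 * (norm w2)\<^sup>2" "0 \<le> a\<^sup>2 * (norm w1)\<^sup>2" by simp_all
  ultimately have "a * bregman_sym \<mu> \<nu> u v
      \<le> d\<^sup>2 * (norm w2)\<^sup>2 + a\<^sup>2 * (norm w1)\<^sup>2 + (d * \<beta>2 + a * \<beta>1) * norm ?e"
    unfolding inner_diff_right inner_scaleR_right distrib_left distrib_right
      right_diff_distrib mult.assoc by linarith
  also have "\<dots> = a * (d\<^sup>2 * (norm w2)\<^sup>2 / a + a * (norm w1)\<^sup>2 + (d * \<beta>2 / a + \<beta>1) * norm ?e)"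
    using pos by (simp add: field_simps power2_eq_square)
  finally show ?thesis using pos by (simp only: mult_le_cancel_left_pos)
qed

section \<open>Powers and rates\<close>

lemma powr_at_right_0:
  assumes "p > (0::real)"
  shows "filterlim (\<lambda>x. x powr p) (at_right 0) (at_right 0)"
proof -
  have "((\<lambda>x::real. x powr p) \<longlongrightarrow> 0 powr p) (at_right 0)"
    using assms by (intro tendsto_powr2 tendsto_const tendsto_ident_at)
      (auto simp: eventually_at_filter)
  moreover have "eventually (\<lambda>x::real. x powr p \<in> {0<..}) (at_right 0)"
    using eventually_at_right_less by eventually_elim simp
  ultimately show ?thesis by (simp add: filterlim_at eventually_conj_iff eventually_mono)
qed

text \<open>
  With \<open>\<beta> = t powr (1 / (1 + r))\<close> the cost \<open>\<beta> powr -r\<close> of the source element, weighted by \<open>t\<close>,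
  equals the size \<open>\<beta>\<close> of the remainder.
\<close>

lemma balanced_powr:
  assumes "t > (0::real)" "r \<ge> 0"
  shows "t * (t powr (1 / (1 + r))) powr (- r) = t powr (1 / (1 + r))"
proof -
  have "t * (t powr (1 / (1 + r))) powr (- r) = t powr (1 + 1 / (1 + r) * (- r))"
    using assms by (simp only: powr_powr powr_add powr_one)
  also have "1 + 1 / (1 + r) * (- r) = 1 / (1 + r)" using assms by (simp add: field_simps)
  finally show ?thesis .
qed

text \<open>
  The exponents left to check once both terms of the balanced bound are compared with
  \<open>\<delta> powr \<rho>\<close>: the strict inequality \<open>\<kappa> < s\<close> makes \<open>\<delta> powr s / \<alpha>\<close> vanish, as the bound on the error norm requires.
\<close>

lemma rate_exponents:
  fixes r1 r2 :: real
  assumes r: "r1 \<ge> 0" "r2 \<ge> 0"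
    and \<kappa>: "\<kappa> = (if r1 \<le> r2 then ((1 + r1) * (2 + r2)) / ((2 + r1) * (1 + r2)) else 1)"
    and \<rho>: "\<rho> = (if r1 \<le> r2 then (2 + r2) / ((2 + r1) * (1 + r2)) else 1 / (1 + r1))"
    and s: "s = (2 + r2) / (1 + r2)"
  shows "0 < \<kappa>" "\<kappa> < s" "\<rho> \<le> s - \<kappa>" "\<rho> = \<kappa> / (1 + r1)"
proof -
  have s_pos: "0 < s" using r by (simp add: s)
  have "0 < \<kappa> \<and> \<kappa> < s \<and> \<rho> \<le> s - \<kappa> \<and> \<rho> = \<kappa> / (1 + r1)"
  proof (cases "r1 \<le> r2")
    case True
    have k: "\<kappa> = (1 + r1) / (2 + r1) * s" and rh: "\<rho> = s / (2 + r1)"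
      using True by (simp_all add: \<kappa> \<rho> s)
    have "s - \<kappa> = \<rho>" using r unfolding k rh by (simp add: field_simps)
    moreover have "0 < \<rho>" using r s_pos by (simp add: rh)
    moreover have "\<rho> = \<kappa> / (1 + r1)" using r unfolding k rh by simp
    moreover have "0 < \<kappa>" using r s_pos by (simp add: k)
    ultimately show ?thesis by simp
  next
    case False
    have "s - 1 = 1 / (1 + r2)" using r by (simp add: s field_simps)
    moreover have "1 / (1 + r1) \<le> 1 / (1 + r2)" using False r by (simp add: frac_le)
    moreover have "0 < 1 / (1 + r2)" using r by simp
    ultimately have "1 < s" "1 / (1 + r1) \<le> s - 1" by linarith+
    then show ?thesis using False by (simp add: \<kappa> \<rho>)
  qed
  then show "0 < \<kappa>" "\<kappa> < s" "\<rho> \<le> s - \<kappa>" "\<rho> = \<kappa> / (1 + r1)" by auto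
qed

section \<open>The convergence rate\<close>

theorem theorem3p4:
  fixes K :: "'x::{banach, second_countable_topology} \<Rightarrow>\<^sub>L
              'y::{real_inner, banach, second_countable_topology}"
    and K\<^sub>Z :: "'x \<Rightarrow>\<^sub>L 'z::banach"
    and \<iota> :: "'z \<Rightarrow>\<^sub>L 'y"
    and R :: "'x \<Rightarrow> real"
    and f :: 'y
    and n :: "'z \<Rightarrow>\<^sub>L real"
    and \<eta> \<mu>dag :: "'x \<Rightarrow>\<^sub>L real"
    and udag :: 'x
    and f\<delta> :: "real \<Rightarrow> 'z \<Rightarrow>\<^sub>L real"
    and u :: "real \<Rightarrow> real \<Rightarrow> 'x"
    and \<mu> :: "real \<Rightarrow> real \<Rightarrow> 'x \<Rightarrow>\<^sub>L real"
    and \<alpha> :: "real \<Rightarrow> real"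
    and r1 r2 C1 C2 \<kappa> :: real
  assumes gelfand: "gelfand_triple \<iota>"
    and K_into_Z: "\<And>v. blinfun_apply \<iota> (blinfun_apply K\<^sub>Z v) = blinfun_apply K v"
    and R_norm: "R = norm"
    and standing: "\<exists>\<tau>. admissible_topology \<tau> R K\<^sub>Z"
    and udag: "is_arg_min R (\<lambda>v. blinfun_apply K v = f) udag"
    and \<mu>dag: "\<mu>dag \<in> subdifferential R udag"
    and data: "\<And>\<delta>. f\<delta> \<delta> = to_dual \<iota> (blinfun_apply K udag) + \<delta> *\<^sub>R n"
    and \<eta>: "\<eta> = dual_adjoint K\<^sub>Z n"
    and u_min: "\<And>a \<delta>. a > 0 \<Longrightarrow> \<delta> > 0 \<Longrightarrow>
        is_arg_min (functional_J K K\<^sub>Z R (f\<delta> \<delta>) a) (\<lambda>_. True) (u a \<delta>)"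
    and \<mu>_subgrad: "\<And>a \<delta>. a > 0 \<Longrightarrow> \<delta> > 0 \<Longrightarrow> \<mu> a \<delta> \<in> subdifferential R (u a \<delta>)"
    and optimality: "\<And>a \<delta>. a > 0 \<Longrightarrow> \<delta> > 0 \<Longrightarrow>
        dual_adjoint K\<^sub>Z (to_dual \<iota> (blinfun_apply K (u a \<delta>)) - f\<delta> \<delta>) + a *\<^sub>R \<mu> a \<delta> = 0"
    and orders: "r1 \<ge> 0" "r2 \<ge> 0"
    and source1: "eventually (\<lambda>\<beta>. source_inf R K\<^sub>Z \<iota> \<mu>dag \<beta> \<le> ereal (C1 * \<beta> powr (- r1))) (at_right 0)"
    and source2: "eventually (\<lambda>\<beta>. source_inf R K\<^sub>Z \<iota> \<eta> \<beta> \<le> ereal (C2 * \<beta> powr (- r2))) (at_right 0)"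
    and \<kappa>: "\<kappa> = (if r1 \<le> r2 then ((1 + r1) * (2 + r2)) / ((2 + r1) * (1 + r2)) else 1)"
    and choice: "\<alpha> \<simeq> (\<lambda>\<delta>. \<delta> powr \<kappa>)"
  shows "(\<lambda>\<delta>. bregman_sym (\<mu> (\<alpha> \<delta>) \<delta>) \<mu>dag (u (\<alpha> \<delta>) \<delta>) udag)
           \<lesssim> (\<lambda>\<delta>. if r1 \<le> r2 then \<delta> powr ((2 + r2) / ((2 + r1) * (1 + r2)))
                   else \<delta> powr (1 / (1 + r1)))"
proof -
  define s where "s = (2 + r2) / (1 + r2)"
  define \<rho> where "\<rho> = (if r1 \<le> r2 then (2 + r2) / ((2 + r1) * (1 + r2)) else 1 / (1 + r1))"
  define \<beta>1 where "\<beta>1 a = a powr (1 / (1 + r1))" for a :: real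
  define \<beta>2 where "\<beta>2 d = d powr (1 / (1 + r2))" for d :: real
  note exps = rate_exponents[OF orders \<kappa> \<rho>_def s_def]
  \<comment> \<open>strictly above \<open>C1\<close> and \<open>C2\<close>, since the infima need not be attained, and positive so that the
      final constant is\<close>
  define B1 B2 where "B1 = \<bar>C1\<bar> + 1" and "B2 = \<bar>C2\<bar> + 1"
  define E where "E = 4 * norm udag + B2"
  have const: "0 < B1" "0 < B2" "C1 < B1" "C2 < B2" "0 \<le> E"
    by (auto simp: B1_def B2_def E_def)

  obtain A where A: "A > 0" "eventually (\<lambda>\<delta>. \<alpha> \<delta> \<le> A * \<delta> powr \<kappa>) (at_right 0)"
    using choice by (auto simp: asymp_eq_def asymp_le_def)
  obtain A' where A': "A' > 0" "eventually (\<lambda>\<delta>. \<delta> powr \<kappa> \<le> A' * \<alpha> \<delta>) (at_right 0)"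
    using choice by (auto simp: asymp_eq_def asymp_le_def)
  have \<delta>_pos: "eventually (\<lambda>\<delta>::real. \<delta> > 0) (at_right 0)"
    by (rule eventually_at_right_less)
  have \<alpha>_pos: "eventually (\<lambda>\<delta>. \<alpha> \<delta> > 0) (at_right 0)"
    using A'(2) \<delta>_pos
  proof eventually_elim
    case (elim \<delta>)
    have "0 < \<delta> powr \<kappa>" using elim by simp
    with elim have "0 < A' * \<alpha> \<delta>" by linarith
    then show ?case using A' by (simp add: zero_less_mult_iff)
  qed
  have powr_lim: "((\<lambda>\<delta>::real. \<delta> powr p) \<longlongrightarrow> 0) (at_right 0)" if "p > 0" for p
    using powr_at_right_0[OF that] by (simp add: filterlim_at)
  have "((\<lambda>\<delta>. A * \<delta> powr \<kappa>) \<longlongrightarrow> 0) (at_right 0)"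
    using tendsto_mult_left[OF powr_lim[OF exps(1)], of A] by simp
  then have "(\<alpha> \<longlongrightarrow> 0) (at_right 0)"
    by (rule tendsto_sandwich[OF _ A(2) tendsto_const, rotated])
      (use \<alpha>_pos in \<open>auto elim: eventually_mono\<close>)
  then have \<alpha>_lim: "filterlim \<alpha> (at_right 0) (at_right 0)"
    using \<alpha>_pos by (simp add: filterlim_at eventually_mono)

  have lim1: "filterlim (\<lambda>\<delta>. \<beta>1 (\<alpha> \<delta>)) (at_right 0) (at_right 0)"
    unfolding \<beta>1_def using orders by (intro filterlim_compose[OF powr_at_right_0 \<alpha>_lim]) simp
  have lim2: "filterlim \<beta>2 (at_right 0) (at_right 0)"
    unfolding \<beta>2_def using orders by (intro powr_at_right_0) simp
  note ev_source1 = eventually_compose_filterlim[OF source1 lim1]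
  note ev_source2 = eventually_compose_filterlim[OF source2 lim2]

  have quotient: "eventually (\<lambda>\<delta>. \<delta> powr s / \<alpha> \<delta> \<le> A' * \<delta> powr (s - \<kappa>)) (at_right 0)"
    using A'(2) \<alpha>_pos \<delta>_pos
  proof eventually_elim
    case (elim \<delta>)
    have "\<delta> powr s = \<delta> powr (s - \<kappa>) * \<delta> powr \<kappa>" by (simp flip: powr_add)
    also have "\<dots> \<le> \<delta> powr (s - \<kappa>) * (A' * \<alpha> \<delta>)" using elim by (intro mult_left_mono) auto
    finally show ?case using elim by (simp add: field_simps)
  qed
  have "((\<lambda>\<delta>. A' * \<delta> powr (s - \<kappa>)) \<longlongrightarrow> 0) (at_right 0)"
    using tendsto_mult_left[OF powr_lim[of "s - \<kappa>"], of A'] exps(2) by simp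
  then have small: "eventually (\<lambda>\<delta>. A' * \<delta> powr (s - \<kappa>) < 1 / 2) (at_right 0)"
    by (rule order_tendstoD) simp
  have less_1: "eventually (\<lambda>\<delta>::real. \<delta> < 1) (at_right 0)"
    by (rule eventually_at_right_real[THEN eventually_mono]) auto

  define M where "M = (B2 + E) * A' + (B1 + E) * A powr (1 / (1 + r1))"
  have "eventually (\<lambda>\<delta>. bregman_sym (\<mu> (\<alpha> \<delta>) \<delta>) \<mu>dag (u (\<alpha> \<delta>) \<delta>) udag \<le> M * \<delta> powr \<rho>) (at_right 0)"
    using ev_source1 ev_source2 \<delta>_pos \<alpha>_pos quotient small less_1 A(2)
  proof eventually_elim
    case (elim \<delta>)
    note \<delta> = \<open>0 < \<delta>\<close> and \<alpha> = \<open>0 < \<alpha> \<delta>\<close>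
    let ?e = "u (\<alpha> \<delta>) \<delta> - udag"
    have \<beta>_pos: "0 < \<beta>1 (\<alpha> \<delta>)" "0 < \<beta>2 \<delta>" using \<delta> \<alpha> by (simp_all add: \<beta>1_def \<beta>2_def)
    have "C1 * \<beta>1 (\<alpha> \<delta>) powr - r1 < B1 * \<beta>1 (\<alpha> \<delta>) powr - r1"
      using const \<beta>_pos by simp
    then obtain w1 where w1: "(norm w1)\<^sup>2 \<le> B1 * \<beta>1 (\<alpha> \<delta>) powr - r1"
      "\<And>v. \<bar>blinfun_apply \<mu>dag v - inner (blinfun_apply K v) w1\<bar> \<le> \<beta>1 (\<alpha> \<delta>) * norm v"
      using source_element[OF K_into_Z elim(1)[unfolded R_norm]] by metis
    have "C2 * \<beta>2 \<delta> powr - r2 < B2 * \<beta>2 \<delta> powr - r2"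
      using const \<beta>_pos by simp
    then obtain w2 where w2: "(norm w2)\<^sup>2 \<le> B2 * \<beta>2 \<delta> powr - r2"
      "\<And>v. \<bar>blinfun_apply \<eta> v - inner (blinfun_apply K v) w2\<bar> \<le> \<beta>2 \<delta> * norm v"
      using source_element[OF K_into_Z elim(2)[unfolded R_norm]] by metis

    have "1 + 1 / (1 + r2) = s" using orders by (simp add: s_def field_simps)
    then have \<delta>\<beta>2: "\<delta> * \<beta>2 \<delta> = \<delta> powr s"
      using \<delta> by (metis \<beta>2_def powr_add powr_one less_imp_le)
    have "\<delta>\<^sup>2 * (norm w2)\<^sup>2 \<le> \<delta>\<^sup>2 * (B2 * \<beta>2 \<delta> powr - r2)"
      using w2(1) by (intro mult_left_mono) auto
    also have "\<dots> = B2 * (\<delta> * (\<delta> * \<beta>2 \<delta> powr - r2))" by (simp add: power2_eq_square)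
    also have "\<dots> = B2 * \<delta> powr s"
      using balanced_powr[OF \<delta> orders(2)] by (simp add: \<delta>\<beta>2 flip: \<beta>2_def)
    finally have cost2: "\<delta>\<^sup>2 * (norm w2)\<^sup>2 \<le> B2 * \<delta> powr s" .
    have "\<alpha> \<delta> * (norm w1)\<^sup>2 \<le> \<alpha> \<delta> * (B1 * \<beta>1 (\<alpha> \<delta>) powr - r1)"
      using w1(1) \<alpha> by (intro mult_left_mono) auto
    also have "\<dots> = B1 * \<beta>1 (\<alpha> \<delta>)"
      using balanced_powr[OF \<alpha> orders(1)] by (simp add: mult.left_commute flip: \<beta>1_def)
    finally have cost1: "\<alpha> \<delta> * (norm w1)\<^sup>2 \<le> B1 * \<beta>1 (\<alpha> \<delta>)" .

    have half: "\<delta> powr s / \<alpha> \<delta> \<le> 1 / 2" using elim by linarith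
    then have half': "\<delta> powr s \<le> \<alpha> \<delta> / 2" using \<alpha> by (simp add: field_simps)
    have energy: "(norm (blinfun_apply K ?e))\<^sup>2 + \<alpha> \<delta> * blinfun_apply (\<mu> (\<alpha> \<delta>) \<delta>) ?e
                  = \<delta> * blinfun_apply \<eta> ?e"
      unfolding \<eta> using energy_identity[OF K_into_Z optimality[OF \<alpha> \<delta>, unfolded data]] .
    have "B2 * \<delta> powr s \<le> B2 * \<alpha> \<delta>" using half' const \<alpha> by (intro mult_left_mono) auto
    then have "\<delta>\<^sup>2 * (norm w2)\<^sup>2 \<le> \<alpha> \<delta> * B2" using cost2 by (simp add: mult.commute)
    then have e: "norm ?e \<le> E"
      unfolding E_def
      using norm_error_le[OF \<alpha> \<delta> energy \<mu>_subgrad[OF \<alpha> \<delta>, unfolded R_norm] w2(2)] half' \<delta>\<beta>2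
      by simp

    have "bregman_sym (\<mu> (\<alpha> \<delta>) \<delta>) \<mu>dag (u (\<alpha> \<delta>) \<delta>) udag
          \<le> \<delta>\<^sup>2 * (norm w2)\<^sup>2 / \<alpha> \<delta> + \<alpha> \<delta> * (norm w1)\<^sup>2 + (\<delta> * \<beta>2 \<delta> / \<alpha> \<delta> + \<beta>1 (\<alpha> \<delta>)) * norm ?e"
      by (rule bregman_le[OF \<alpha> \<delta> energy w1(2) w2(2)])
    also have "\<dots> \<le> B2 * \<delta> powr s / \<alpha> \<delta> + B1 * \<beta>1 (\<alpha> \<delta>) + (\<delta> powr s / \<alpha> \<delta> + \<beta>1 (\<alpha> \<delta>)) * E"
      unfolding \<delta>\<beta>2 using cost1 cost2 e \<alpha> \<beta>_pos
      by (intro add_mono mult_left_mono divide_right_mono) auto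
    also have "\<dots> = (B2 + E) * (\<delta> powr s / \<alpha> \<delta>) + (B1 + E) * \<beta>1 (\<alpha> \<delta>)"
      by (simp add: algebra_simps add_divide_distrib)
    also have "\<dots> \<le> (B2 + E) * (A' * \<delta> powr \<rho>) + (B1 + E) * (A powr (1 / (1 + r1)) * \<delta> powr \<rho>)"
    proof (intro add_mono mult_left_mono)
      have "\<delta> powr (s - \<kappa>) \<le> \<delta> powr \<rho>"
        using \<delta> \<open>\<delta> < 1\<close> exps(3) by (intro powr_mono') auto
      then have "A' * \<delta> powr (s - \<kappa>) \<le> A' * \<delta> powr \<rho>" using A' by simp
      with elim show "\<delta> powr s / \<alpha> \<delta> \<le> A' * \<delta> powr \<rho>" by linarith
      have "\<beta>1 (\<alpha> \<delta>) \<le> (A * \<delta> powr \<kappa>) powr (1 / (1 + r1))"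
        unfolding \<beta>1_def using elim \<alpha> orders by (intro powr_mono2) auto
      also have "\<dots> = A powr (1 / (1 + r1)) * \<delta> powr \<rho>"
        using A by (simp add: powr_mult powr_powr exps(4))
      finally show "\<beta>1 (\<alpha> \<delta>) \<le> A powr (1 / (1 + r1)) * \<delta> powr \<rho>" .
    qed (use const in auto)
    also have "\<dots> = M * \<delta> powr \<rho>" by (simp add: M_def algebra_simps)
    finally show ?case .
  qed
  moreover have "M > 0"
    unfolding M_def using const A A' by (intro add_pos_pos mult_pos_pos add_pos_nonneg) auto
  moreover have "(\<lambda>\<delta>. if r1 \<le> r2 then \<delta> powr ((2 + r2) / ((2 + r1) * (1 + r2)))
                   else \<delta> powr (1 / (1 + r1))) = (\<lambda>\<delta>. \<delta> powr \<rho>)"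
    by (simp add: \<rho>_def)
  ultimately show ?thesis by (auto simp: asymp_le_def)
qed

end
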